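(* Let $n,p\in\{1,2,3,\ldots\}$, let $A,B\in\mathbb{R}^{p\times n}$ with $\operatorname{rank}(A\ B)=p$, and let $G:\mathbb{R}^n\rightrightarrows\mathbb{R}^n$ be the linear relation with $\operatorname{gra} G=\{(x,x^* )\in\mathbb{R}^n\times\mathbb{R}^n\mid Ax+Bx^*=0\}$. Define the linear relation $\widehat G:\mathbb{R}^n\rightrightarrows\mathbb{R}^n$ by $$\operatorname{gra}\widehat G=\{(B^{\intercal}u,-A^{\intercal}u)\mid u\in \mathbf{V_-}(BA^{\intercal})+\mathbf{V_0}(BA^{\intercal})\}.$$ Then the following are equivalent: (i) $G$ is maximally monotone; (ii) $p=n$ and $G$ is monotone; (iii) $p=n$ and $AB^{\intercal}+BA^{\intercal}$ is negative semidefinite; (iv) $p=n$ and $\widehat G$ is maximally monotone.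
   Context: $\mathbb{R}^n$ carries the Euclidean inner product $\langle\cdot,\cdot\rangle$. A set-valued operator $T:\mathbb{R}^n\rightrightarrows\mathbb{R}^n$ is identified with its graph $\operatorname{gra}T=\{(x,x^* )\mid x^*\in Tx\}$; it is a linear relation if $\operatorname{gra}T$ is a linear subspace. $T$ is monotone if $\langle x-y,x^*-y^*\rangle\ge0$ for all $(x,x^* ),(y,y^* )\in\operatorname{gra}T$, and maximally monotone if it is monotone and has no proper monotone extension (in the sense of graph inclusion, among all set-valued operators). For a square matrix $M$, $\mathbf{V_0}(M)$ and $\mathbf{V_-}(M)$ denote the spans of the eigenvectors of the symmetric matrix $M+M^{\intercal}$ belonging to the zero eigenvalue and to negative eigenvalues, respectively. *)

theory Defs
  imports "HOL-Analysis.Analysis" "HOL-Library.Set_Algebras"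
begin

definition gra :: "('a \<Rightarrow> 'b set) \<Rightarrow> ('a \<times> 'b) set" where
  "gra T = {(x, y). y \<in> T x}"

definition linear_relation :: "('a::real_vector \<Rightarrow> 'b::real_vector set) \<Rightarrow> bool" where
  "linear_relation T \<longleftrightarrow> subspace (gra T)"

definition monotone_operator :: "('a::real_inner \<Rightarrow> 'a set) \<Rightarrow> bool" where
  "monotone_operator T \<longleftrightarrow>
     (\<forall>(x, x') \<in> gra T. \<forall>(y, y') \<in> gra T. (x - y) \<bullet> (x' - y') \<ge> 0)"

text \<open>Extensions are arbitrary set-valued operators, not only linear relations.\<close>

definition maximally_monotone :: "('a::real_inner \<Rightarrow> 'a set) \<Rightarrow> bool" where
  "maximally_monotone T \<longleftrightarrow> monotone_operator T \<and>
     (\<forall>S. monotone_operator S \<and> gra T \<subseteq> gra S \<longrightarrow> gra S = gra T)"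

text \<open>The block matrix \<open>(A B)\<close>; its columns are indexed by the disjoint union of
  the column index types of \<open>A\<close> and \<open>B\<close>.\<close>

definition hblock :: "'a^'n^'p \<Rightarrow> 'a^'m^'p \<Rightarrow> 'a^('n + 'm)^'p" where
  "hblock A B = (\<chi> i j. case j of Inl k \<Rightarrow> A $ i $ k | Inr k \<Rightarrow> B $ i $ k)"

definition negative_semidefinite :: "real^'p^'p \<Rightarrow> bool" where
  "negative_semidefinite M \<longleftrightarrow> transpose M = M \<and> (\<forall>x. x \<bullet> (M *v x) \<le> 0)"

definition is_eigenvector :: "real^'p^'p \<Rightarrow> real \<Rightarrow> real^'p \<Rightarrow> bool" where
  "is_eigenvector M l v \<longleftrightarrow> v \<noteq> 0 \<and> M *v v = l *\<^sub>R v"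

text \<open>The eigenvectors below are those of the symmetric matrix \<open>M + transpose M\<close>, not of
  \<open>M\<close>. The span of the empty set is \<open>{0}\<close>.\<close>

definition V_zero :: "real^'p^'p \<Rightarrow> (real^'p) set" where
  "V_zero M = span {v. is_eigenvector (M + transpose M) 0 v}"

definition V_neg :: "real^'p^'p \<Rightarrow> (real^'p) set" where
  "V_neg M = span {v. \<exists>l<0. is_eigenvector (M + transpose M) l v}"

lemma linear_relation_kernel:
  fixes A B :: "real^'n^'p"
  assumes "gra G = {(x, x'). A *v x + B *v x' = 0}"
  shows "linear_relation G"
proof -
  have lin: "linear (\<lambda>z. A *v fst z + B *v snd z)"
    by (rule linearI) (simp_all add: matrix_vector_right_distrib matrix_vector_mult_scaleR
        scaleR_add_right)
  have "gra G = {z. A *v fst z + B *v snd z = 0}"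
    using assms by auto
  then show ?thesis
    unfolding linear_relation_def using linear_subspace_kernel[OF lin] by simp
qed

lemma linear_relation_image:
  fixes A B :: "real^'n^'p"
  assumes "gra H = {(transpose B *v u, - (transpose A *v u)) | u. u \<in> V_neg M + V_zero M}"
  shows "linear_relation H"
proof -
  have lin: "linear (\<lambda>u. (transpose B *v u, - (transpose A *v u)))"
    by (rule linearI) (simp_all add: matrix_vector_right_distrib matrix_vector_mult_scaleR)
  have "V_neg M + V_zero M = {x + y | x y. x \<in> V_neg M \<and> y \<in> V_zero M}"
    by (auto simp: set_plus_def)
  then have "subspace (V_neg M + V_zero M)"
    unfolding V_neg_def V_zero_def by (simp add: subspace_sums)
  moreover have "gra H = (\<lambda>u. (transpose B *v u, - (transpose A *v u))) ` (V_neg M + V_zero M)"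
    using assms by auto
  ultimately show ?thesis
    unfolding linear_relation_def using linear_subspace_image[OF lin] by simp
qed

end

theory Submission
  imports Defs
begin

text \<open>On a monotone linear relation \<open>T\<close> the map \<open>(x, x') \<mapsto> x + x'\<close> is injective, so the dimension of
  the graph is at most \<open>n\<close>, and \<open>T\<close> is maximal iff this map is onto, i.e. iff the dimension is \<open>n\<close>
  (Minty). The graph of \<open>G\<close> has dimension \<open>2 * n - p\<close>, which gives the equivalence of (i) and (ii).
  The relation \<open>{(B\<^sup>T u, - A\<^sup>T u)}\<close> is the adjoint of \<open>G\<close> and has dimension \<open>p\<close>; it is monotone
  iff \<open>A B\<^sup>T + B A\<^sup>T\<close> is negative semidefinite. For \<open>p = n\<close>, a relation of dimension \<open>n\<close> is monotone
  iff its adjoint is, whence (iii). Finally \<open>Ghat\<close> is a restriction of the adjoint: under (iii) the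
  spectral theorem makes it all of the adjoint, and under (iv) a dimension count does.\<close>

section \<open>Monotone linear relations\<close>

lemma gra_inject:
  assumes "gra S = gra T"
  shows "S = T"
proof
  have "U x = {y. (x, y) \<in> gra U}" for U :: "'a \<Rightarrow> 'b set" and x
    by (simp add: gra_def)
  then show "S x = T x" for x
    by (metis assms)
qed

text \<open>Differences of graph points are again graph points, so comparison with
  \<open>(0, 0)\<close> suffices.\<close>

lemma monotone_linear_relation_iff:
  assumes "linear_relation T"
  shows "monotone_operator T \<longleftrightarrow> (\<forall>(x, x') \<in> gra T. 0 \<le> x \<bullet> x')"
proof
  assume m: "monotone_operator T"
  have "(0, 0) \<in> gra T"
    using subspace_0[OF assms[unfolded linear_relation_def]] by (simp add: zero_prod_def)
  then have "0 \<le> (x - 0) \<bullet> (x' - 0)" if "(x, x') \<in> gra T" for x x'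
    using m that unfolding monotone_operator_def by blast
  then show "\<forall>(x, x') \<in> gra T. 0 \<le> x \<bullet> x'"
    by auto
next
  assume nn: "\<forall>(x, x') \<in> gra T. 0 \<le> x \<bullet> x'"
  have "0 \<le> (x - y) \<bullet> (x' - y')" if "(x, x') \<in> gra T" "(y, y') \<in> gra T" for x x' y y'
    using subspace_diff[OF assms[unfolded linear_relation_def] that] nn by auto
  then show "monotone_operator T"
    unfolding monotone_operator_def by auto
qed

lemma linear_add_prod: "linear (\<lambda>(x, x'). x + x')"
  by (rule linearI) (auto simp: algebra_simps)

text \<open>Equal sums give \<open>x' - y' = - (x - y)\<close>, and monotonicity then makes minus
  the squared norm of \<open>x - y\<close> nonnegative.\<close>

lemma inj_on_add_monotone:
  assumes "linear_relation T" "monotone_operator T"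
  shows "inj_on (\<lambda>(x, x'). x + x') (gra T)"
proof -
  have "x = y \<and> x' = y'" if T: "(x, x') \<in> gra T" "(y, y') \<in> gra T" and eq: "x + x' = y + y'"
    for x x' y y'
  proof -
    have "x' - y' = - (x - y)"
      using eq by (simp add: algebra_simps)
    moreover have "0 \<le> (x - y) \<bullet> (x' - y')"
      using T assms(2) unfolding monotone_operator_def by auto
    ultimately have "x - y = 0"
      by (metis inner_ge_zero inner_minus_right inner_eq_zero_iff neg_0_le_iff_le antisym)
    then show ?thesis
      using eq by simp
  qed
  then show ?thesis
    unfolding inj_on_def by auto
qed

lemma add_surj_iff_dim:
  fixes T :: "'a::euclidean_space \<Rightarrow> 'a set"
  assumes "linear_relation T" "monotone_operator T"
  shows "(\<lambda>(x, x'). x + x') ` gra T = UNIV \<longleftrightarrow> dim (gra T) = DIM('a)"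
proof -
  have S: "subspace (gra T)"
    using assms(1) by (simp add: linear_relation_def)
  have "dim ((\<lambda>(x, x'). x + x') ` gra T) = dim (gra T)"
    using inj_on_add_monotone[OF assms] S
    by (intro dim_image_eq linear_add_prod) (simp add: span_eq_iff[THEN iffD2])
  moreover have "subspace ((\<lambda>(x, x'). x + x') ` gra T)"
    by (rule linear_subspace_image[OF linear_add_prod S])
  ultimately show ?thesis
    by (metis dim_UNIV dim_eq_full span_eq_iff)
qed

text \<open>Linear case of Minty's theorem. If the sums fill the space, each pair of a monotone
  extension shares its sum with a graph point, and the injectivity argument identifies the two.
  Otherwise a nonzero vector orthogonal to all sums yields a proper extension.\<close>

lemma maximally_monotone_iff_surj:
  assumes lin: "linear_relation T" and mono: "monotone_operator T"
  shows "maximally_monotone T \<longleftrightarrow> (\<lambda>(x, x'). x + x') ` gra T = (UNIV :: 'a::euclidean_space set)"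
proof
  assume surj: "(\<lambda>(x, x'). x + x') ` gra T = UNIV"
  have "gra S \<subseteq> gra T" if S: "monotone_operator S" "gra T \<subseteq> gra S" for S
  proof clarify
    fix a b assume ab: "(a, b) \<in> gra S"
    obtain x x' where x: "(x, x') \<in> gra T" "a + b = x + x'"
      using surj by (smt (verit) UNIV_I imageE case_prod_beta prod.collapse)
    then have "b - x' = - (a - x)"
      by (simp add: algebra_simps)
    moreover have "0 \<le> (a - x) \<bullet> (b - x')"
      using S ab x(1) unfolding monotone_operator_def by blast
    ultimately have "a - x = 0"
      by (metis inner_ge_zero inner_minus_right inner_eq_zero_iff neg_0_le_iff_le antisym)
    with x show "(a, b) \<in> gra T"
      by simp
  qed
  with mono show "maximally_monotone T"
    unfolding maximally_monotone_def by blast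
next
  assume max: "maximally_monotone T"
  let ?D = "(\<lambda>(x, x'). x + x') ` gra T"
  have S: "subspace ?D"
    using lin linear_subspace_image[OF linear_add_prod] by (auto simp: linear_relation_def)
  show "?D = UNIV"
  proof (rule ccontr)
    assume "?D \<noteq> UNIV"
    then have "dim ?D < DIM('a)"
      by (metis S dim_eq_full dim_subset_UNIV nat_less_le span_eq_iff)
    then obtain w where w: "w \<noteq> 0" and orth: "\<And>y. y \<in> span ?D \<Longrightarrow> orthogonal w y"
      using orthogonal_to_subspace_exists by blast
    have w0: "w \<bullet> (x + x') = 0" if "(x, x') \<in> gra T" for x x'
      using orth[OF span_base] that by (force simp: orthogonal_def)
    txt \<open>The pair \<open>(w, w)\<close> is monotonically related to \<open>T\<close> but lies outside its graph.\<close>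
    have nn: "0 \<le> (w - x) \<bullet> (w - x')" if "(x, x') \<in> gra T" for x x'
    proof -
      have "(w - x) \<bullet> (w - x') = w \<bullet> w - w \<bullet> (x + x') + x \<bullet> x'"
        by (simp add: inner_diff inner_add inner_commute algebra_simps)
      also have "\<dots> = w \<bullet> w + x \<bullet> x'"
        using w0[OF that] by simp
      also have "\<dots> \<ge> 0"
        using that mono monotone_linear_relation_iff[OF lin] by fastforce
      finally show ?thesis .
    qed
    have nn': "0 \<le> (x - w) \<bullet> (x' - w)" if "(x, x') \<in> gra T" for x x'
      using nn[OF that] by (metis inner_minus_left inner_minus_right minus_diff_eq minus_minus)
    define T' where "T' = T(w := insert w (T w))"
    have gra': "gra T' = insert (w, w) (gra T)"
      by (auto simp: T'_def gra_def split: if_splits)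
    have "monotone_operator T'"
      using mono nn nn' unfolding monotone_operator_def gra' by auto
    then have "gra T' = gra T"
      using max gra' unfolding maximally_monotone_def by blast
    \<comment> \<open>With \<open>(w, w)\<close> in the graph of \<open>T\<close>, its sum
      \<open>w + w\<close> is orthogonal to \<open>w\<close>.\<close>
    then have "w \<bullet> (w + w) = 0"
      using gra' w0 by blast
    with w show False
      by (simp add: inner_add_right)
  qed
qed

lemma maximally_monotone_iff_dim:
  fixes T :: "'a::euclidean_space \<Rightarrow> 'a set"
  assumes "linear_relation T"
  shows "maximally_monotone T \<longleftrightarrow> monotone_operator T \<and> dim (gra T) = DIM('a)"
proof -
  have "monotone_operator T" if "maximally_monotone T"
    using that unfolding maximally_monotone_def by (rule conjunct1)
  moreover have "maximally_monotone T \<longleftrightarrow> dim (gra T) = DIM('a)" if mono: "monotone_operator T"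
    by (rule trans[OF maximally_monotone_iff_surj[OF assms mono] add_surj_iff_dim[OF assms mono]])
  ultimately show ?thesis
    by iprover
qed

text \<open>The hypothesis \<open>adj\<close> places \<open>(y, y')\<close> in the adjoint of
  \<open>T\<close>; in this pointwise form two mutually adjoint relations can exchange
  roles.\<close>

lemma adjoint_monotone:
  fixes T :: "'a::euclidean_space \<Rightarrow> 'a set"
  assumes lin: "linear_relation T" and max: "maximally_monotone T"
    and adj: "\<And>x x'. (x, x') \<in> gra T \<Longrightarrow> x' \<bullet> y = x \<bullet> y'"
  shows "0 \<le> y \<bullet> y'"
proof -
  have mono: "monotone_operator T"
    using max unfolding maximally_monotone_def by (rule conjunct1)
  txt \<open>In the coordinates \<open>s = x + x'\<close>, \<open>d = x - x'\<close> the relation \<open>T\<close> is the graph of a contraction,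
    and the adjoint relation is the graph of the transposed contraction.\<close>
  have "y - y' \<in> (\<lambda>(x, x'). x + x') ` gra T"
    using max maximally_monotone_iff_surj[OF lin mono] by simp
  \<comment> \<open>The graph point with sum \<open>y - y'\<close> turns the pairing identity below
    into a formula for the squared norm of \<open>y - y'\<close>.\<close>
  then obtain x x' where x: "(x, x') \<in> gra T" "x + x' = y - y'"
    by auto
  \<comment> \<open>The squared norms of \<open>x + x'\<close> and \<open>x - x'\<close> differ by
    \<open>4 * (x \<bullet> x')\<close>; the end of the proof uses this identity for
    \<open>(y, y')\<close> in reverse.\<close>
  have contr: "norm (x - x') \<le> norm (x + x')"
  proof -
    have "0 \<le> x \<bullet> x'"
      using x(1) mono monotone_linear_relation_iff[OF lin] by auto
    then show ?thesis
      unfolding norm_le by (simp add: inner_diff inner_add inner_commute)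
  qed
  have "(x + x') \<bullet> (y - y') = (x - x') \<bullet> (y + y')"
    using adj[OF x(1)] by (simp add: inner_diff inner_add inner_commute)
  then have "norm (y - y') ^ 2 = (x - x') \<bullet> (y + y')"
    using x(2) by (simp add: power2_norm_eq_inner)
  also have "\<dots> \<le> norm (x - x') * norm (y + y')"
    by (rule norm_cauchy_schwarz)
  also have "\<dots> \<le> norm (y - y') * norm (y + y')"
    using contr x(2) by (simp add: mult_right_mono)
  finally have "norm (y - y') \<le> norm (y + y')"
    by (cases "norm (y - y') = 0") (auto simp: power2_eq_square)
  then show ?thesis
    unfolding norm_le by (simp add: inner_diff inner_add inner_commute)
qed

section \<open>The spectral theorem\<close>

text \<open>The orthogonal complement of all eigenvectors is invariant under \<open>M\<close>. Were
  it nonzero, the quadratic form would attain a maximum on its unit sphere, and the maximizer would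
  be an eigenvector orthogonal to itself.\<close>

lemma span_eigenvectors_symmetric:
  fixes M :: "real^'n^'n"
  assumes sym: "transpose M = M"
  shows "span {v. \<exists>l. is_eigenvector M l v} = UNIV"
proof (rule ccontr)
  let ?E = "{v. \<exists>l. is_eigenvector M l v}"
  assume "span ?E \<noteq> UNIV"
  then have "dim ?E < DIM(real^'n)"
    using dim_eq_full[of ?E] dim_subset_UNIV[of ?E] by linarith
  then obtain x where x: "x \<noteq> 0" "\<And>y. y \<in> span ?E \<Longrightarrow> orthogonal x y"
    by (rule orthogonal_to_subspace_exists) auto
  have selfadj: "(M *v u) \<bullet> v = u \<bullet> (M *v v)" for u v
    using dot_lmul_matrix[of u M v] transpose_matrix_vector[of M u] sym by simp
  define U where "U = {u. \<forall>v \<in> ?E. v \<bullet> u = 0}"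
  have scaleU: "c *\<^sub>R u \<in> U" if "u \<in> U" for c u
    using that by (auto simp: U_def)
  have addU: "u + w \<in> U" if "u \<in> U" "w \<in> U" for u w
    using that by (auto simp: U_def inner_add_right)
  have MU: "M *v u \<in> U" if "u \<in> U" for u
  proof -
    have "v \<bullet> (M *v u) = 0" if v: "is_eigenvector M l v" for v l
    proof -
      have "v \<bullet> (M *v u) = l * (v \<bullet> u)"
        using v selfadj[of v u] by (simp add: is_eigenvector_def)
      then show ?thesis
        using \<open>u \<in> U\<close> v by (auto simp: U_def)
    qed
    then show ?thesis
      by (auto simp: U_def)
  qed
  have "U = (\<Inter>v \<in> ?E. {u. v \<bullet> u = 0})"
    by (auto simp: U_def)
  then have "closed U"
    by (simp add: closed_INT closed_hyperplane)
  then have "compact (sphere 0 1 \<inter> U)"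
    by (simp add: compact_Int_closed)
  moreover have xU: "x \<in> U"
    using x(2)[OF span_base] by (auto simp: U_def orthogonal_def inner_commute)
  then have "(1 / norm x) *\<^sub>R x \<in> sphere 0 1 \<inter> U"
    using x(1) scaleU by simp
  then have "sphere 0 1 \<inter> U \<noteq> {}"
    by blast
  moreover have "continuous_on (sphere 0 1 \<inter> U) (\<lambda>u. u \<bullet> (M *v u))"
    by (intro continuous_intros linear_continuous_on matrix_vector_mul_bounded_linear)
  ultimately obtain v where vK: "v \<in> sphere 0 1 \<inter> U"
      "\<forall>u \<in> sphere 0 1 \<inter> U. u \<bullet> (M *v u) \<le> v \<bullet> (M *v v)"
    using continuous_attains_sup[of "sphere 0 1 \<inter> U" "\<lambda>u. u \<bullet> (M *v u)"] by blast
  then have v: "v \<in> U" "norm v = 1"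
    and v_max: "\<And>u. u \<in> U \<Longrightarrow> norm u = 1 \<Longrightarrow> u \<bullet> (M *v u) \<le> v \<bullet> (M *v v)"
    by auto
  define l where "l = v \<bullet> (M *v v)"
  have bound: "u \<bullet> (M *v u) \<le> l * (u \<bullet> u)" if "u \<in> U" for u
  proof (cases "u = 0")
    case False
    have "((1 / norm u) *\<^sub>R u) \<bullet> (M *v ((1 / norm u) *\<^sub>R u)) \<le> l"
      unfolding l_def using that False by (intro v_max scaleU) auto
    then have "(u \<bullet> (M *v u)) / (norm u)\<^sup>2 \<le> l"
      by (simp add: matrix_vector_mult_scaleR power2_eq_square)
    then show ?thesis
      using False by (simp add: divide_le_eq dot_square_norm)
  qed simp
  txt \<open>First-order condition at the maximizer, in the direction of the residual \<open>w\<close>.\<close>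
  define w where "w = M *v v - l *\<^sub>R v"
  have wU: "w \<in> U"
    unfolding w_def using addU[OF MU[OF v(1)] scaleU[OF v(1), of "- l"]] by simp
  define a where "a = w \<bullet> w"
  define c where "c = l * (w \<bullet> w) - w \<bullet> (M *v w)"
  \<comment> \<open>This is \<open>bound\<close> at \<open>v + t *\<^sub>R w\<close>: the constant
    terms cancel because \<open>l\<close> is the value at the unit vector \<open>v\<close>, and the
    linear coefficient is \<open>2 * a\<close> by the choice of \<open>w\<close>.\<close>
  have quad: "2 * t * a \<le> t\<^sup>2 * c" for t
  proof -
    have "(v + t *\<^sub>R w) \<bullet> (M *v (v + t *\<^sub>R w)) \<le> l * ((v + t *\<^sub>R w) \<bullet> (v + t *\<^sub>R w))"
      by (intro bound addU scaleU v wU)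
    moreover have "v \<bullet> (M *v w) = w \<bullet> (M *v v)"
      using selfadj[of v w] by (simp add: inner_commute)
    moreover have "v \<bullet> v = 1"
      using v(2) by (simp add: dot_square_norm)
    moreover have "w \<bullet> (M *v v) = a + l * (v \<bullet> w)"
      unfolding a_def by (subst (3) w_def) (simp add: inner_diff_right inner_commute)
    ultimately show ?thesis
      by (simp add: c_def l_def[symmetric] matrix_vector_right_distrib matrix_vector_mult_scaleR
          inner_add_left inner_add_right inner_commute power2_eq_square algebra_simps)
  qed
  have "a \<le> 0"
  proof (rule ccontr)
    assume "\<not> a \<le> 0"
    \<comment> \<open>For \<open>t = a / (\<bar>c\<bar> + 1)\<close> the product
      \<open>t * c\<close> is at most \<open>a\<close>, whereas \<open>quad\<close> demands at least
      \<open>2 * a\<close>; the added 1 keeps the denominator positive.\<close>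
    then have "0 < a / (\<bar>c\<bar> + 1)"
      by (simp add: add_nonneg_pos)
    moreover have "2 * (a / (\<bar>c\<bar> + 1)) * a \<le> (a / (\<bar>c\<bar> + 1)) * (a / (\<bar>c\<bar> + 1) * c)"
      using quad[of "a / (\<bar>c\<bar> + 1)"] by (simp add: power2_eq_square mult.assoc)
    ultimately have "2 * a \<le> a / (\<bar>c\<bar> + 1) * c"
      by (simp only: mult.commute[of 2] mult.assoc mult_le_cancel_left_pos) 
    then have "2 * a * (\<bar>c\<bar> + 1) \<le> a * c"
      by (simp add: field_simps)
    moreover have "a * c \<le> a * (\<bar>c\<bar> + 1)"
      using \<open>\<not> a \<le> 0\<close> by (intro mult_left_mono) auto
    moreover have "0 < a * (\<bar>c\<bar> + 1)"
      using \<open>\<not> a \<le> 0\<close> by (simp add: add_nonneg_pos)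
    ultimately show False
      by simp
  qed
  then have "w = 0"
    unfolding a_def by (metis inner_gt_zero_iff not_less)
  then have "is_eigenvector M l v"
    using v(2) by (auto simp: is_eigenvector_def w_def)
  then have "v \<bullet> v = 0"
    using v(1) by (auto simp: U_def)
  with v(2) show False
    by auto
qed

text \<open>Semidefiniteness excludes positive eigenvalues, so the two spanning sets together
  contain every eigenvector.\<close>

lemma V_neg_plus_V_zero_eq_UNIV:
  assumes nsd: "negative_semidefinite (M + transpose M)"
  shows "V_neg M + V_zero M = UNIV"
proof -
  let ?N = "M + transpose M"
  have "l \<le> 0" if "is_eigenvector ?N l v" for l v
  proof -
    have "l * (v \<bullet> v) = v \<bullet> (?N *v v)"
      using that by (simp add: is_eigenvector_def del: transpose_matrix_vector)
    also have "\<dots> \<le> 0"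
      using nsd by (simp add: negative_semidefinite_def)
    finally have "l * (v \<bullet> v) \<le> 0" .
    moreover have "0 < v \<bullet> v"
      using that by (simp add: is_eigenvector_def)
    ultimately show ?thesis
      by (simp add: mult_le_0_iff)
  qed
  then have "{v. \<exists>l. is_eigenvector ?N l v} =
      {v. \<exists>l<0. is_eigenvector ?N l v} \<union> {v. is_eigenvector ?N 0 v}"
    by (force simp: order_le_less)
  moreover have "span {v. \<exists>l. is_eigenvector ?N l v} = UNIV"
    using nsd by (intro span_eigenvectors_symmetric) (simp add: negative_semidefinite_def)
  ultimately have "{a + b | a b. a \<in> V_neg M \<and> b \<in> V_zero M} = UNIV"
    unfolding V_neg_def V_zero_def span_Un[symmetric] by (simp only:)
  then show ?thesis
    unfolding set_plus_def by blast
qed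

section \<open>Kernel and range representations\<close>

lemma hblock_mult_vec:
  "hblock A B *v z = A *v (\<chi> k. z $ Inl k) + B *v (\<chi> k. z $ Inr k)"
  by (simp add: vec_eq_iff hblock_def matrix_vector_mult_def UNIV_Plus_UNIV[symmetric]
      sum.Plus del: UNIV_Plus_UNIV)

context
  fixes A B :: "real^'n^'p"
  assumes full_rank: "rank (hblock A B) = CARD('p)"
begin

text \<open>Full row rank makes the block matrix surjective, so \<open>u\<close> lies in its range,
  to which the assumptions make \<open>u\<close> orthogonal.\<close>

lemma full_rank_kernel:
  assumes "transpose A *v u = 0" "transpose B *v u = 0"
  shows "u = 0"
proof -
  obtain z where "u = hblock A B *v z"
    using full_rank full_rank_surjective[of "hblock A B"] by (metis surjD)
  then have "u \<bullet> u = u \<bullet> (A *v (\<chi> k. z $ Inl k) + B *v (\<chi> k. z $ Inr k))"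
    by (simp add: hblock_mult_vec)
  also have "\<dots> = 0"
    using assms by (simp add: inner_add_right dot_lmul_matrix[symmetric])
  finally show ?thesis
    by simp
qed

lemma dim_range_representation:
  assumes "subspace U"
  shows "dim {(transpose B *v u, - (transpose A *v u)) | u. u \<in> U} = dim U"
proof -
  let ?L = "\<lambda>u. (transpose B *v u, - (transpose A *v u))"
  have lin: "linear ?L"
    by (rule linearI) (simp_all add: matrix_vector_right_distrib matrix_vector_mult_scaleR
        del: transpose_matrix_vector)
  have "inj ?L"
    unfolding linear_injective_0[OF lin] using full_rank_kernel
    by (auto simp: zero_prod_def simp del: transpose_matrix_vector)
  then have "dim (?L ` U) = dim U"
    by (intro dim_image_eq lin) (rule inj_on_subset, auto)
  moreover have "?L ` U = {?L u | u. u \<in> U}"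
    by auto
  ultimately show ?thesis
    by simp
qed

text \<open>The kernel is the orthogonal complement of the range of the injective map
  \<open>?L\<close>. The additive form avoids truncated subtraction.\<close>

lemma dim_kernel_representation:
  "dim {(x, x'). A *v x + B *v x' = 0} + CARD('p) = 2 * CARD('n)"
proof -
  let ?L = "\<lambda>u. (transpose A *v u, transpose B *v u)"
  have lin: "linear ?L"
    by (rule linearI) (simp_all add: matrix_vector_right_distrib matrix_vector_mult_scaleR
        del: transpose_matrix_vector)
  have "inj ?L"
    unfolding linear_injective_0[OF lin] using full_rank_kernel
    by (auto simp: zero_prod_def simp del: transpose_matrix_vector)
  then have "dim (range ?L) = CARD('p)"
    by (subst dim_image_eq[OF lin]) (auto intro: inj_on_subset)
  moreover have "dim {z \<in> UNIV. \<forall>y \<in> range ?L. orthogonal y z} + dim (range ?L) =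
      dim (UNIV :: ((real^'n) \<times> (real^'n)) set)"
    by (intro dim_subspace_orthogonal_to_vectors linear_subspace_image[OF lin]) auto
  moreover have "{z \<in> UNIV. \<forall>y \<in> range ?L. orthogonal y z} = {(x, x'). A *v x + B *v x' = 0}"
  proof -
    have "orthogonal (?L u) (x, x') \<longleftrightarrow> u \<bullet> (A *v x + B *v x') = 0" for u x x'
      by (simp add: orthogonal_def dot_lmul_matrix inner_add_right)
    then show ?thesis
      by (auto simp del: transpose_matrix_vector) (metis inner_eq_zero_iff)
  qed
  ultimately show ?thesis
    by simp
qed

end

section \<open>Equivalence of the four conditions through the adjoint of \<open>G\<close>\<close>

theorem theorem3p6:
  fixes A B :: "real^'n^'p"
    and G Ghat :: "real^'n \<Rightarrow> (real^'n) set"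
  assumes "rank (hblock A B) = CARD('p)"
    and "gra G = {(x, x'). A *v x + B *v x' = 0}"
    and "gra Ghat = {(transpose B *v u, - (transpose A *v u)) | u.
           u \<in> V_neg (B ** transpose A) + V_zero (B ** transpose A)}"
  shows "(maximally_monotone G \<longleftrightarrow> CARD('p) = CARD('n) \<and> monotone_operator G)
    \<and> (CARD('p) = CARD('n) \<and> monotone_operator G \<longleftrightarrow>
        CARD('p) = CARD('n) \<and> negative_semidefinite (A ** transpose B + B ** transpose A))
    \<and> (CARD('p) = CARD('n) \<and> negative_semidefinite (A ** transpose B + B ** transpose A) \<longleftrightarrow>
        CARD('p) = CARD('n) \<and> maximally_monotone Ghat)"
proof -
  let ?M = "A ** transpose B + B ** transpose A"
  let ?V = "V_neg (B ** transpose A) + V_zero (B ** transpose A)"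
  \<comment> \<open>\<open>R\<close> is the adjoint of \<open>G\<close>, obtained by letting
    \<open>u\<close> range over the whole space in the formula for \<open>Ghat\<close>.\<close>
  define R where "R x = {x'. (x, x') \<in> {(transpose B *v u, - (transpose A *v u)) | u. u \<in> UNIV}}"
    for x :: "real^'n"
  have graR: "gra R = {(transpose B *v u, - (transpose A *v u)) | u. u \<in> UNIV}"
    by (auto simp: R_def gra_def)
  have M: "B ** transpose A + transpose (B ** transpose A) = ?M"
    by (simp add: matrix_transpose_mul add.commute)
  have linG: "linear_relation G" and linGhat: "linear_relation Ghat"
    using linear_relation_kernel[OF assms(2)] linear_relation_image[OF assms(3)] by auto
  have linR: "linear_relation R"
  proof -
    have "linear (\<lambda>u. (transpose B *v u, - (transpose A *v u)))"
      by (rule linearI) (simp_all add: matrix_vector_right_distrib matrix_vector_mult_scaleR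
        del: transpose_matrix_vector)
    then have "subspace (range (\<lambda>u. (transpose B *v u, - (transpose A *v u))))"
      by (intro linear_subspace_image) auto
    then show ?thesis
      unfolding linear_relation_def graR by (simp add: full_SetCompr_eq del: transpose_matrix_vector)
  qed
  have subV: "subspace ?V"
  proof -
    have "?V = {x + y | x y. x \<in> V_neg (B ** transpose A) \<and> y \<in> V_zero (B ** transpose A)}"
      by (auto simp: set_plus_def)
    then show ?thesis
      unfolding V_neg_def V_zero_def by (simp add: subspace_sums)
  qed
  have dimG: "dim (gra G) + CARD('p) = 2 * CARD('n)"
    unfolding assms(2) by (rule dim_kernel_representation[OF assms(1)])
  have dimR: "dim (gra R) = CARD('p)"
    unfolding graR by (subst dim_range_representation[OF assms(1)]) auto
  have dimGhat: "dim (gra Ghat) = dim ?V"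
    unfolding assms(3) by (rule dim_range_representation[OF assms(1) subV])

  have i_ii: "maximally_monotone G \<longleftrightarrow> CARD('p) = CARD('n) \<and> monotone_operator G"
    using maximally_monotone_iff_dim[OF linG] dimG by auto
  have maxR: "maximally_monotone R \<longleftrightarrow> CARD('p) = CARD('n) \<and> monotone_operator R"
    using maximally_monotone_iff_dim[OF linR] dimR by auto

  have monoR: "monotone_operator R \<longleftrightarrow> negative_semidefinite ?M"
  proof -
    have "transpose ?M = ?M"
      unfolding M[symmetric] by (simp add: transpose_def vec_eq_iff)
    \<comment> \<open>Both summands of \<open>?M\<close> give the same inner product, hence the
      factor 2; the sign comes from the second component of \<open>R\<close>.\<close>
    moreover have "u \<bullet> (?M *v u) = - 2 * ((transpose B *v u) \<bullet> - (transpose A *v u))" for u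
    proof -
      have "u \<bullet> ((A ** transpose B) *v u) = (transpose A *v u) \<bullet> (transpose B *v u)"
        by (simp add: matrix_vector_mul_assoc[symmetric] dot_lmul_matrix[symmetric])
      moreover have "u \<bullet> ((B ** transpose A) *v u) = (transpose B *v u) \<bullet> (transpose A *v u)"
        by (simp add: matrix_vector_mul_assoc[symmetric] dot_lmul_matrix[symmetric])
      ultimately show ?thesis
        by (simp add: matrix_vector_mult_add_rdistrib inner_add_right inner_commute
            del: transpose_matrix_vector)
    qed
    moreover have "(\<forall>(x, x') \<in> gra R. 0 \<le> x \<bullet> x') \<longleftrightarrow>
        (\<forall>u. 0 \<le> (transpose B *v u) \<bullet> - (transpose A *v u))"
      unfolding graR by blast
    ultimately show ?thesis
      unfolding monotone_linear_relation_iff[OF linR] negative_semidefinite_def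
      by (simp del: transpose_matrix_vector)
  qed

  have adj: "x' \<bullet> y = x \<bullet> y'" if x: "(x, x') \<in> gra G" and y: "(y, y') \<in> gra R" for x x' y y'
  proof -
    obtain u where u: "y = transpose B *v u" "y' = - (transpose A *v u)"
      using y unfolding graR by auto
    have "x' \<bullet> y - x \<bullet> y' = u \<bullet> (A *v x + B *v x')"
      unfolding u by (simp add: inner_add_right dot_lmul_matrix inner_commute[of _ "_ v* _"])
    then show ?thesis
      using x unfolding assms(2) by simp
  qed
  \<comment> \<open>Equal cardinalities upgrade monotone to maximally monotone for either relation,
    and \<open>adj\<close> is symmetric in the two.\<close>
  have "monotone_operator G \<longleftrightarrow> monotone_operator R" if "CARD('p) = CARD('n)"
  proof
    assume "monotone_operator G"
    then have "maximally_monotone G"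
      using i_ii that by simp
    then show "monotone_operator R"
      unfolding monotone_linear_relation_iff[OF linR]
      using adjoint_monotone[OF linG] adj by fast
  next
    assume "monotone_operator R"
    then have "maximally_monotone R"
      using maxR that by simp
    then show "monotone_operator G"
      unfolding monotone_linear_relation_iff[OF linG]
      using adjoint_monotone[OF linR] adj by (metis (mono_tags, lifting) case_prodI2 inner_commute)
  qed
  then have ii_iii: "CARD('p) = CARD('n) \<and> monotone_operator G \<longleftrightarrow>
      CARD('p) = CARD('n) \<and> negative_semidefinite ?M"
    using monoR by blast

  have GhatR: "Ghat = R" if "?V = UNIV"
    by (rule gra_inject) (simp only: assms(3) graR that)
  have "maximally_monotone Ghat" if "CARD('p) = CARD('n)" "negative_semidefinite ?M"
  proof -
    have "?V = UNIV"
      using that(2) by (intro V_neg_plus_V_zero_eq_UNIV) (simp only: M)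
    then have "Ghat = R"
      by (rule GhatR)
    then show ?thesis
      using maxR monoR that by simp
  qed
  \<comment> \<open>Maximality forces the graph of \<open>Ghat\<close> to have full dimension, which
    leaves no room for \<open>?V\<close> to be a proper subspace.\<close>
  moreover have "negative_semidefinite ?M" if "CARD('p) = CARD('n)" "maximally_monotone Ghat"
  proof -
    have "dim ?V = CARD('p)"
      using that dimGhat maximally_monotone_iff_dim[OF linGhat] by simp
    then have "?V = UNIV"
      using subV by (metis DIM_cart DIM_real dim_eq_full mult.right_neutral span_eq_iff)
    then have "Ghat = R"
      by (rule GhatR)
    then show ?thesis
      using that maxR monoR by simp
  qed
  ultimately show ?thesis
    using i_ii ii_iii by blast
qed

end
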